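(* Suppose $F:\mathbb R^d\to\mathbb R$ has partial derivatives that are $L_2$-smooth w.r.t. $\|\cdot\|_1$. Let $x^1,\dots,x^T\in\Delta_d$ be deterministic vectors and $a^1,\dots,a^T\in\Delta_d$ be random vectors such that $\mathbb E[a^t\mid a^{t-1},\dots,a^1]=x^t$ for all $t\in[T]$. Let $\bar x^T=\frac1T\sum_{t=1}^Tx^t$ and $\bar a^T=\frac1T\sum_{t=1}^Ta^t$. Then $$\big\|\mathbb E[\nabla F(\bar a^T)-\nabla F(\bar x^T)]\big\|_\infty\le\frac{2L_2}{T}.$$
   Context: $\Delta_d=\{x\in\mathbb R^d:x_j\ge0,\ \sum_jx_j=1\}$. A differentiable function $G:\mathbb R^d\to\mathbb R$ is $L$-smooth w.r.t. $\|\cdot\|_1$ if $\|\nabla G(u)-\nabla G(u')\|_\infty\le L\|u-u'\|_1$ for all $u,u'$. *)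

theory Defs
  imports "HOL-Probability.Probability"
begin

definition prob_simplex :: "(real ^ 'd) set" where
  "prob_simplex = {x. (\<forall>j. 0 \<le> x $ j) \<and> (\<Sum>j\<in>UNIV. x $ j) = 1}"

definition l1norm :: "real ^ 'd \<Rightarrow> real" where
  "l1norm x = (\<Sum>j\<in>UNIV. \<bar>x $ j\<bar>)"

definition has_partials :: "(real ^ 'd \<Rightarrow> real) \<Rightarrow> bool" where
  "has_partials F \<longleftrightarrow> (\<forall>u j. (\<lambda>h. F (u + h *\<^sub>R axis j 1)) field_differentiable (at 0))"

definition partial :: "(real ^ 'd \<Rightarrow> real) \<Rightarrow> 'd \<Rightarrow> real ^ 'd \<Rightarrow> real" where
  "partial F j u = deriv (\<lambda>h. F (u + h *\<^sub>R axis j 1)) 0"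

(* The gradient is the vector of partial derivatives; it is only used where these exist. *)
definition grad :: "(real ^ 'd \<Rightarrow> real) \<Rightarrow> real ^ 'd \<Rightarrow> real ^ 'd" where
  "grad F u = (\<chi> j. partial F j u)"

(* infnorm is the maximum norm of the coordinates. *)
definition smooth_l1 :: "real \<Rightarrow> (real ^ 'd \<Rightarrow> real) \<Rightarrow> bool" where
  "smooth_l1 L G \<longleftrightarrow>
     (\<forall>u. G differentiable (at u)) \<and>
     (\<forall>u u'. infnorm (grad G u - grad G u') \<le> L * l1norm (u - u'))"

(* The sigma-algebra on the sample space generated by a 1, ..., a (t - 1), as the pullback of the
   product sigma-algebra along the tuple of these variables. For t = 1 the index set is empty and
   the sigma-algebra is trivial, so conditioning on it is taking the plain expectation. *)
definition past_algebra ::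
    "'w measure \<Rightarrow> (nat \<Rightarrow> 'w \<Rightarrow> real ^ 'd) \<Rightarrow> nat \<Rightarrow> 'w measure" where
  "past_algebra M a t =
     vimage_algebra (space M) (\<lambda>\<omega>. \<lambda>s\<in>{1..<t}. a s \<omega>) (\<Pi>\<^sub>M s\<in>{1..<t}. borel)"

(* E[X | N] = Y almost surely for vector-valued X, taken coordinatewise: the library's
   conditional expectation is real-valued. *)
definition cond_exp_vec_eq ::
    "'w measure \<Rightarrow> 'w measure \<Rightarrow> ('w \<Rightarrow> real ^ 'd) \<Rightarrow> ('w \<Rightarrow> real ^ 'd) \<Rightarrow> bool" where
  "cond_exp_vec_eq M N X Y \<longleftrightarrow>
     (\<forall>j. AE \<omega> in M. real_cond_exp M N (\<lambda>\<omega>. X \<omega> $ j) \<omega> = Y \<omega> $ j)"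

definition average :: "nat \<Rightarrow> (nat \<Rightarrow> real ^ 'd) \<Rightarrow> real ^ 'd" where
  "average T v = (1 / real T) *\<^sub>R (\<Sum>t = 1..T. v t)"

end

theory Submission
  imports Defs
begin

text \<open>
  The average of the \<open>a t\<close> is the average of the \<open>x t\<close> plus a sum of the increments
  \<open>(a t - x t) / T\<close>, which are martingale differences. Adding them one at a time and expanding a
  partial derivative \<open>G\<close> of \<open>F\<close> to first order around the previous partial sum, the linear
  term has expectation zero because the gradient at the previous partial sum depends on the past
  only. The remainder is at most \<open>L / 2\<close> times the square of the \<open>l1\<close> norm of the increment,
  hence at most \<open>2 * L / T\<^sup>2\<close>. Summing these errors over the \<open>T\<close> steps gives the bound.
\<close>

section \<open>The l1 norm and the simplex\<close>

lemma l1norm_nonneg: "0 \<le> l1norm u"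
  by (simp add: l1norm_def sum_nonneg)

lemma l1norm_triangle: "l1norm (u + v) \<le> l1norm u + l1norm v"
  unfolding l1norm_def sum.distrib[symmetric] by (intro sum_mono) simp

lemma l1norm_scaleR: "l1norm (c *\<^sub>R u) = \<bar>c\<bar> * l1norm u"
  by (simp add: l1norm_def abs_mult sum_distrib_left)

lemma norm_le_l1norm: "norm u \<le> l1norm u"
  unfolding l1norm_def by (rule norm_le_l1_cart)

lemma l1norm_prob_simplex: "u \<in> prob_simplex \<Longrightarrow> l1norm u = 1"
  by (simp add: prob_simplex_def l1norm_def)

text \<open>The l1 diameter of the simplex; divided by \<open>T\<close> it bounds every
  increment.\<close>

lemma l1norm_diff_prob_simplex:
  assumes "u \<in> prob_simplex" "v \<in> prob_simplex"
  shows "l1norm (u - v) \<le> 2"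
  using l1norm_triangle[of u "(-1) *\<^sub>R v"] assms
  unfolding l1norm_scaleR by (simp add: l1norm_prob_simplex)

lemma infnorm_le_cart:
  fixes u :: "real ^ 'd"
  assumes "\<And>j. \<bar>u $ j\<bar> \<le> c"
  shows "infnorm u \<le> c"
  unfolding infnorm_cart using assms by (intro cSup_least) auto

section \<open>First-order expansion of l1-smooth functions\<close>

text \<open>By the chain rule along coordinate lines, any derivative \<open>D\<close> at
  \<open>u\<close> takes the value \<open>partial G j u\<close> on \<open>axis j 1\<close>;
  linearity and the basis expansion then determine \<open>D\<close>. This links the one-dimensional
  \<open>deriv\<close> in \<open>partial\<close> to the multivariate derivative.\<close>

lemma has_derivative_partial:
  fixes G :: "real ^ 'd \<Rightarrow> real"
  assumes "G differentiable (at u)"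
  shows "(G has_derivative (\<lambda>h. \<Sum>j\<in>UNIV. partial G j u * h $ j)) (at u)"
proof -
  obtain D where D: "(G has_derivative D) (at u)"
    using assms by (auto simp: differentiable_def)
  have lin: "linear D"
    using D by (rule has_derivative_linear)
  have part: "partial G j u = D (axis j 1)" for j
  proof -
    have "((\<lambda>h. u + h *\<^sub>R axis j 1) has_derivative (\<lambda>h. h *\<^sub>R axis j 1)) (at 0)"
      by (auto intro!: derivative_eq_intros)
    then have "((\<lambda>h. G (u + h *\<^sub>R axis j 1)) has_derivative (\<lambda>h. D (h *\<^sub>R axis j 1))) (at 0)"
      by (rule has_derivative_compose) (simp add: D)
    then have "((\<lambda>h. G (u + h *\<^sub>R axis j 1)) has_real_derivative D (axis j 1)) (at 0)"
      unfolding has_field_derivative_def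
      by (simp add: linear_cmul[OF lin] mult_commute_abs)
    then show ?thesis
      unfolding partial_def by (rule DERIV_imp_deriv)
  qed
  have "D h = (\<Sum>j\<in>UNIV. partial G j u * h $ j)" for h
  proof -
    have "D h = D (\<Sum>j\<in>UNIV. (h $ j) *\<^sub>R axis j 1)"
      by (simp add: basis_expansion flip: scalar_mult_eq_scaleR)
    also have "\<dots> = (\<Sum>j\<in>UNIV. partial G j u * h $ j)"
      by (simp add: linear_sum[OF lin] linear_cmul[OF lin] part mult.commute)
    finally show ?thesis .
  qed
  then have "D = (\<lambda>h. \<Sum>j\<in>UNIV. partial G j u * h $ j)"
    by (rule ext)
  with D show ?thesis
    by simp
qed

text \<open>Subtracting \<open>s * f' 0 + C / 2 * s\<^sup>2\<close> from \<open>f\<close> leaves a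
  function with nonpositive derivative on [0, 1]. The bound is one-sided so that it can be applied
  to both \<open>f\<close> and \<open>-f\<close>.\<close>

lemma taylor_first_order_upper:
  fixes f f' :: "real \<Rightarrow> real"
  assumes "\<And>s. 0 \<le> s \<Longrightarrow> s \<le> 1 \<Longrightarrow> (f has_real_derivative f' s) (at s)"
    and "\<And>s. 0 \<le> s \<Longrightarrow> s \<le> 1 \<Longrightarrow> f' s - f' 0 \<le> C * s"
  shows "f 1 - f 0 - f' 0 \<le> C / 2"
proof -
  have "f 1 - 1 * f' 0 - C / 2 * 1\<^sup>2 \<le> f 0 - 0 * f' 0 - C / 2 * 0\<^sup>2"
  proof (rule DERIV_nonpos_imp_nonincreasing[of 0 1 "\<lambda>s. f s - s * f' 0 - C / 2 * s\<^sup>2"])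
    fix s :: real
    assume s: "0 \<le> s" "s \<le> 1"
    have "((\<lambda>s. f s - s * f' 0 - C / 2 * s\<^sup>2) has_real_derivative f' s - f' 0 - C * s) (at s)"
      using assms(1)[OF s] by (auto intro!: derivative_eq_intros)
    then show "\<exists>y. ((\<lambda>s. f s - s * f' 0 - C / 2 * s\<^sup>2) has_real_derivative y) (at s) \<and> y \<le> 0"
      using assms(2)[OF s] by force
  qed simp
  then show ?thesis
    by simp
qed

lemma smooth_l1_partial_diff:
  assumes "smooth_l1 L G"
  shows "\<bar>partial G j u - partial G j v\<bar> \<le> L * l1norm (u - v)"
proof -
  have "\<bar>(grad G u - grad G v) $ j\<bar> \<le> infnorm (grad G u - grad G v)"
    by (rule component_le_infnorm_cart)
  also have "\<dots> \<le> L * l1norm (u - v)"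
    using assms by (simp add: smooth_l1_def)
  finally show ?thesis
    by (simp add: grad_def)
qed

text \<open>Here \<open>1\<close> is the all-ones vector, which has positive l1 norm, and
  \<open>undefined\<close> serves as an arbitrary coordinate. The sign of \<open>L\<close> matters
  when a bound multiplied by \<open>L\<close> is enlarged.\<close>

lemma smooth_l1_nonneg:
  fixes G :: "real ^ 'd \<Rightarrow> real"
  assumes "smooth_l1 L G"
  shows "0 \<le> L"
proof -
  have "0 < l1norm (1 - 0 :: real ^ 'd)"
    by (simp add: l1norm_def)
  moreover have "0 \<le> L * l1norm (1 - 0 :: real ^ 'd)"
    using smooth_l1_partial_diff[OF assms, of undefined 1 0] by linarith
  ultimately show ?thesis
    by (simp add: zero_le_mult_iff)
qed

text \<open>On the line \<open>u + s *\<^sub>R h\<close> the slope moves by at most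
  \<open>L * (l1norm h)\<^sup>2 * s\<close>: one factor \<open>l1norm h\<close> measures the
  displacement in the Lipschitz bound on the gradient, the other comes from pairing the gradient
  with \<open>h\<close>.\<close>

lemma smooth_l1_taylor:
  assumes G: "smooth_l1 L G"
  shows "\<bar>G (u + h) - G u - (\<Sum>j\<in>UNIV. partial G j u * h $ j)\<bar> \<le> L / 2 * (l1norm h)\<^sup>2"
proof -
  define f where "f s = G (u + s *\<^sub>R h)" for s
  define f' where "f' s = (\<Sum>j\<in>UNIV. partial G j (u + s *\<^sub>R h) * h $ j)" for s
  have deriv: "(f has_real_derivative f' s) (at s)" for s
  proof -
    have "((\<lambda>s. u + s *\<^sub>R h) has_derivative (\<lambda>r. r *\<^sub>R h)) (at s)"
      by (auto intro!: derivative_eq_intros)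
    moreover have "G differentiable (at (u + s *\<^sub>R h))"
      using G by (simp add: smooth_l1_def)
    ultimately have "(f has_derivative
        (\<lambda>r. \<Sum>j\<in>UNIV. partial G j (u + s *\<^sub>R h) * (r *\<^sub>R h) $ j)) (at s)"
      unfolding f_def by (rule has_derivative_compose[OF _ has_derivative_partial])
    moreover have "(\<Sum>j\<in>UNIV. partial G j (u + s *\<^sub>R h) * (r *\<^sub>R h) $ j) = f' s * r" for r
      by (simp add: f'_def sum_distrib_left mult_ac)
    ultimately show ?thesis
      by (simp add: has_field_derivative_def)
  qed
  have bound: "\<bar>f' s - f' 0\<bar> \<le> L * (l1norm h)\<^sup>2 * s" if "0 \<le> s" for s
  proof -
    have "\<bar>f' s - f' 0\<bar> = \<bar>\<Sum>j\<in>UNIV. (partial G j (u + s *\<^sub>R h) - partial G j u) * h $ j\<bar>"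
      by (simp add: f'_def sum_subtractf left_diff_distrib)
    \<comment> \<open>Hoelder's inequality for the maximum and l1 norms, carried out
      coordinatewise.\<close>
    also have "\<dots> \<le> (\<Sum>j\<in>UNIV. \<bar>partial G j (u + s *\<^sub>R h) - partial G j u\<bar> * \<bar>h $ j\<bar>)"
      by (rule order.trans[OF sum_abs]) (simp add: abs_mult)
    also have "\<dots> \<le> (\<Sum>j\<in>UNIV. (L * (s * l1norm h)) * \<bar>h $ j\<bar>)"
      using smooth_l1_partial_diff[OF G, of _ "u + s *\<^sub>R h" u] that
      by (intro sum_mono mult_right_mono) (auto simp: l1norm_scaleR)
    also have "\<dots> = (L * (s * l1norm h)) * l1norm h"
      by (simp add: l1norm_def sum_distrib_left)
    finally show ?thesis
      by (simp add: power2_eq_square mult_ac)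
  qed
  have "f 1 - f 0 - f' 0 \<le> L * (l1norm h)\<^sup>2 / 2"
    by (rule taylor_first_order_upper[OF deriv]) (use bound in \<open>force simp: abs_le_iff\<close>)
  moreover have "- f 1 - - f 0 - - f' 0 \<le> L * (l1norm h)\<^sup>2 / 2"
    by (rule taylor_first_order_upper[of "\<lambda>s. - f s" "\<lambda>s. - f' s"])
      (use deriv bound in \<open>force simp: abs_le_iff intro: DERIV_minus\<close>)+
  ultimately have "\<bar>f 1 - f 0 - f' 0\<bar> \<le> L / 2 * (l1norm h)\<^sup>2"
    unfolding times_divide_eq_left by linarith
  then show ?thesis
    by (simp add: f_def f'_def)
qed

lemma smooth_l1_continuous: "smooth_l1 L G \<Longrightarrow> continuous_on UNIV G"
  by (simp add: smooth_l1_def continuous_at_imp_continuous_on differentiable_imp_continuous_within)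

text \<open>Follows by squeezing with the Lipschitz bound. It supplies the measurability and
  integrability of the linear Taylor term.\<close>

lemma smooth_l1_continuous_partial:
  fixes G :: "real ^ 'd \<Rightarrow> real"
  assumes G: "smooth_l1 L G"
  shows "continuous_on UNIV (partial G j)"
proof -
  have "isCont (partial G j) u" for u
  proof -
    have "isCont (\<lambda>v. L * l1norm (v - u)) u"
      unfolding l1norm_def by (intro continuous_intros)
    then have "((\<lambda>v. L * l1norm (v - u)) \<longlongrightarrow> 0) (at u)"
      by (simp add: isCont_def l1norm_def)
    then have "((\<lambda>v. partial G j v - partial G j u) \<longlongrightarrow> 0) (at u)"
      by (rule Lim_null_comparison[rotated])
        (use smooth_l1_partial_diff[OF G] in auto)
    then show ?thesis
      by (simp add: isCont_def LIM_zero_iff)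
  qed
  then show ?thesis
    by (simp add: continuous_at_imp_continuous_on)
qed

section \<open>Expectations along martingale increments\<close>

text \<open>Almost surely \<open>Z\<close> stays in a closed ball, which is compact, so
  \<open>g\<close> is bounded there.\<close>

lemma (in finite_measure) integrable_continuous_bounded:
  fixes g :: "'b::euclidean_space \<Rightarrow> 'c::{banach, second_countable_topology}"
  assumes g: "continuous_on UNIV g" and Z: "Z \<in> borel_measurable M"
    and bd: "AE \<omega> in M. norm (Z \<omega>) \<le> B"
  shows "integrable M (\<lambda>\<omega>. g (Z \<omega>))"
proof -
  have "bounded (g ` cball 0 B)"
    using g by (intro compact_imp_bounded compact_continuous_image)
      (auto intro: continuous_on_subset)
  then obtain K where K: "\<And>u. norm u \<le> B \<Longrightarrow> norm (g u) \<le> K"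
    unfolding bounded_iff by (metis image_eqI mem_cball_0)
  show ?thesis
  proof (rule integrable_const_bound)
    show "AE \<omega> in M. norm (g (Z \<omega>)) \<le> K"
      using bd by eventually_elim (rule K)
    show "(\<lambda>\<omega>. g (Z \<omega>)) \<in> borel_measurable M"
      using borel_measurable_continuous_onI[OF g] Z by (rule measurable_compose[rotated])
  qed
qed

lemma (in prob_space) expectation_smooth_step:
  assumes G: "smooth_l1 L G" and N: "subalgebra M N"
    and Z: "Z \<in> borel_measurable N" "AE \<omega> in M. norm (Z \<omega>) \<le> B"
    and D: "D \<in> borel_measurable M" "AE \<omega> in M. l1norm (D \<omega>) \<le> c"
    and mart: "cond_exp_vec_eq M N D (\<lambda>\<omega>. 0)"
  shows "\<bar>expectation (\<lambda>\<omega>. G (Z \<omega> + D \<omega>)) - expectation (\<lambda>\<omega>. G (Z \<omega>))\<bar> \<le> L / 2 * c\<^sup>2"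
proof -
  \<comment> \<open>A finite measure restricted to a subalgebra remains finite, hence sigma-finite,
    as the theory of \<open>real_cond_exp\<close> demands.\<close>
  interpret sigma_finite_subalgebra M N
    using N by (intro finite_measure_subalgebra_is_sigma_finite)
      (simp add: finite_measure_subalgebra_def finite_measure_subalgebra_axioms_def
        finite_measure_axioms)
  have ZM: "Z \<in> borel_measurable M"
    using measurable_from_subalg[OF N Z(1)] .
  have D': "AE \<omega> in M. norm (D \<omega>) \<le> c"
    using D(2) by eventually_elim (use norm_le_l1norm order.trans in blast)
  have ZD: "AE \<omega> in M. norm (Z \<omega> + D \<omega>) \<le> B + c"
    using Z(2) D' by eventually_elim (use norm_triangle_mono in blast)
  have intZ: "integrable M (\<lambda>\<omega>. G (Z \<omega>))"
    by (rule integrable_continuous_bounded[OF smooth_l1_continuous[OF G] ZM Z(2)])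
  have intZD: "integrable M (\<lambda>\<omega>. G (Z \<omega> + D \<omega>))"
    by (rule integrable_continuous_bounded[OF smooth_l1_continuous[OF G] _ ZD]) (use ZM D in simp)
  \<comment> \<open>The product is a continuous function of the pair
    \<open>(Z \<omega>, D \<omega>)\<close>, which is almost surely bounded by
    \<open>B + c\<close>.\<close>
  have lin_int: "integrable M (\<lambda>\<omega>. partial G j (Z \<omega>) * D \<omega> $ j)" for j
  proof -
    have "integrable M (\<lambda>\<omega>. (\<lambda>p. partial G j (fst p) * snd p $ j) (Z \<omega>, D \<omega>))"
    proof (rule integrable_continuous_bounded[where g = "\<lambda>p. partial G j (fst p) * snd p $ j"])
      show "continuous_on UNIV (\<lambda>p. partial G j (fst p) * snd p $ j)"
        by (intro continuous_intros continuous_on_compose2[OF smooth_l1_continuous_partial[OF G]])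
          auto
      show "AE \<omega> in M. norm (Z \<omega>, D \<omega>) \<le> B + c"
        using Z(2) D' by eventually_elim (rule order.trans[OF norm_Pair_le], simp)
    qed (use ZM D in measurable)
    then show ?thesis
      by simp
  qed
  \<comment> \<open>The factor \<open>partial G j (Z \<omega>)\<close> is
    \<open>N\<close>-measurable, so under the integral \<open>D \<omega> $ j\<close> may be replaced
    by its conditional expectation, which vanishes almost everywhere.\<close>
  have lin0: "expectation (\<lambda>\<omega>. partial G j (Z \<omega>) * D \<omega> $ j) = 0" for j
  proof -
    have Dj: "(\<lambda>\<omega>. D \<omega> $ j) \<in> borel_measurable M"
      using D(1) by (rule measurable_compose)
        (intro borel_measurable_continuous_onI continuous_intros)
    have "(\<lambda>\<omega>. partial G j (Z \<omega>)) \<in> borel_measurable N"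
      using borel_measurable_continuous_onI[OF smooth_l1_continuous_partial[OF G]] Z(1)
      by (rule measurable_compose[rotated])
    then have "expectation (\<lambda>\<omega>. partial G j (Z \<omega>) * D \<omega> $ j) =
        expectation (\<lambda>\<omega>. partial G j (Z \<omega>) * real_cond_exp M N (\<lambda>\<omega>. D \<omega> $ j) \<omega>)"
      using real_cond_exp_intg(2)[OF lin_int _ Dj] by simp
    also have "\<dots> = 0"
    proof (rule integral_eq_zero_AE)
      have "AE \<omega> in M. real_cond_exp M N (\<lambda>\<omega>. D \<omega> $ j) \<omega> = 0"
        using mart by (simp add: cond_exp_vec_eq_def)
      then show "AE \<omega> in M. partial G j (Z \<omega>) * real_cond_exp M N (\<lambda>\<omega>. D \<omega> $ j) \<omega> = 0"
        by eventually_elim simp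
    qed
    finally show ?thesis .
  qed
  \<comment> \<open>The Taylor remainder: its expectation equals the difference to be bounded, since
    the linear part integrates to zero.\<close>
  define R where "R \<omega> = G (Z \<omega> + D \<omega>) - G (Z \<omega>) - (\<Sum>j\<in>UNIV. partial G j (Z \<omega>) * D \<omega> $ j)" for \<omega>
  have intR: "integrable M R"
    unfolding R_def using intZ intZD lin_int by simp
  have "expectation R = expectation (\<lambda>\<omega>. G (Z \<omega> + D \<omega>)) - expectation (\<lambda>\<omega>. G (Z \<omega>))"
    unfolding R_def using intZ intZD lin_int by (simp add: lin0)
  moreover have "\<bar>expectation R\<bar> \<le> L / 2 * c\<^sup>2"
  proof -
    have "AE \<omega> in M. \<bar>R \<omega>\<bar> \<le> L / 2 * c\<^sup>2"
      using D(2)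
    proof eventually_elim
      case (elim \<omega>)
      have "\<bar>R \<omega>\<bar> \<le> L / 2 * (l1norm (D \<omega>))\<^sup>2"
        unfolding R_def by (rule smooth_l1_taylor[OF G])
      also have "\<dots> \<le> L / 2 * c\<^sup>2"
        using elim l1norm_nonneg smooth_l1_nonneg[OF G]
        by (intro mult_left_mono power_mono) auto
      finally show ?case .
    qed
    then have "expectation (\<lambda>\<omega>. \<bar>R \<omega>\<bar>) \<le> L / 2 * c\<^sup>2"
      by (intro integral_le_const) (use intR in auto)
    then show ?thesis
      using integral_abs_bound[of M R] by linarith
  qed
  ultimately show ?thesis
    by simp
qed

text \<open>Induction on the number of increments: each new one costs
  \<open>L / 2 * c\<^sup>2\<close> by the one-step estimate, with the sum of the earlier ones,
  shifted by \<open>z\<close>, as base point.\<close>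

lemma (in prob_space) expectation_smooth_martingale:
  assumes G: "smooth_l1 L G"
    and N: "\<And>t. t \<in> {1..n} \<Longrightarrow> subalgebra M (N t)"
    and adapted: "\<And>s t. t \<in> {1..n} \<Longrightarrow> s \<in> {1..<t} \<Longrightarrow> D s \<in> borel_measurable (N t)"
    and D: "\<And>t. t \<in> {1..n} \<Longrightarrow> D t \<in> borel_measurable M"
      "\<And>t. t \<in> {1..n} \<Longrightarrow> AE \<omega> in M. l1norm (D t \<omega>) \<le> c"
    and mart: "\<And>t. t \<in> {1..n} \<Longrightarrow> cond_exp_vec_eq M (N t) (D t) (\<lambda>\<omega>. 0)"
  shows "\<bar>expectation (\<lambda>\<omega>. G (z + (\<Sum>t = 1..n. D t \<omega>))) - G z\<bar> \<le> real n * (L / 2 * c\<^sup>2)"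
  \<comment> \<open>These hypotheses range over \<open>{1..n}\<close>, so they take part in the
    induction and are restricted to the shorter range for the induction hypothesis.\<close>
  using N adapted D mart
proof (induction n)
  case 0
  then show ?case
    by (simp add: prob_space)
next
  case (Suc n)
  define Z where "Z \<omega> = z + (\<Sum>t = 1..n. D t \<omega>)" for \<omega>
  have IH: "\<bar>expectation (\<lambda>\<omega>. G (Z \<omega>)) - G z\<bar> \<le> real n * (L / 2 * c\<^sup>2)"
    unfolding Z_def using Suc.prems by (intro Suc.IH) auto
  \<comment> \<open>Only increments with index below \<open>Suc n\<close> enter \<open>Z\<close>,
    exactly those that \<open>adapted\<close> makes measurable for \<open>N (Suc n)\<close>.\<close>
  have Zm: "Z \<in> borel_measurable (N (Suc n))"
    unfolding Z_def using Suc.prems(2)[of "Suc n"]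
    by (intro borel_measurable_add borel_measurable_sum) auto
  have "AE \<omega> in M. \<forall>t\<in>{1..n}. l1norm (D t \<omega>) \<le> c"
    using Suc.prems(4) by (intro AE_finite_allI) auto
  \<comment> \<open>A crude bound suffices: it secures integrability and does not enter the final
    estimate.\<close>
  then have bd: "AE \<omega> in M. norm (Z \<omega>) \<le> norm z + real n * c"
  proof eventually_elim
    case (elim \<omega>)
    have "norm (\<Sum>t = 1..n. D t \<omega>) \<le> (\<Sum>t = 1..n. c)"
      using elim by (intro sum_norm_le) (meson norm_le_l1norm order.trans)
    then show ?case
      unfolding Z_def by (intro norm_triangle_mono) auto
  qed
  have "\<bar>expectation (\<lambda>\<omega>. G (Z \<omega> + D (Suc n) \<omega>)) - expectation (\<lambda>\<omega>. G (Z \<omega>))\<bar> \<le> L / 2 * c\<^sup>2"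
    using Suc.prems by (intro expectation_smooth_step[OF G _ Zm bd]) auto
  then have "\<bar>expectation (\<lambda>\<omega>. G (Z \<omega> + D (Suc n) \<omega>)) - G z\<bar> \<le> real (Suc n) * (L / 2 * c\<^sup>2)"
    using IH unfolding of_nat_Suc distrib_right by linarith
  then show ?case
    by (simp add: Z_def add.assoc)
qed

section \<open>The sigma-algebra of the past and centering\<close>

text \<open>The tuple of earlier variables is measurable on \<open>M\<close>, so pulling back the
  product sigma-algebra along it yields only sets of \<open>M\<close>.\<close>

lemma subalgebra_past_algebra:
  assumes "\<And>s. s \<in> {1..<t} \<Longrightarrow> a s \<in> borel_measurable M"
  shows "subalgebra M (past_algebra M a t)"
proof -
  have "(\<lambda>\<omega>. \<lambda>s\<in>{1..<t}. a s \<omega>) \<in> measurable M (\<Pi>\<^sub>M s\<in>{1..<t}. borel)"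
    using assms by (rule measurable_restrict)
  then show ?thesis
    unfolding subalgebra_def past_algebra_def
    by (auto simp: sets_vimage_algebra measurable_sets
        intro!: sets.sigma_sets_subset dest: measurable_space)
qed

lemma measurable_past_algebra:
  assumes "s \<in> {1..<t}"
  shows "a s \<in> borel_measurable (past_algebra M a t)"
proof -
  have "(\<lambda>\<omega>. \<lambda>s\<in>{1..<t}. a s \<omega>) \<in> measurable (past_algebra M a t) (\<Pi>\<^sub>M s\<in>{1..<t}. borel)"
    unfolding past_algebra_def by (rule measurable_vimage_algebra1) (auto simp: space_PiM)
  from measurable_compose[OF this measurable_component_singleton[OF assms]]
  show ?thesis
    using assms by simp
qed

text \<open>Linearity of conditional expectation, together with the fact that a constant is its own
  conditional expectation. This turns the mean condition on \<open>a t\<close> into the martingale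
  difference property of the scaled increments.\<close>

lemma (in prob_space) cond_exp_vec_eq_centered:
  assumes N: "subalgebra M N" and X: "integrable M X"
    and eq: "cond_exp_vec_eq M N X (\<lambda>\<omega>. v)"
  shows "cond_exp_vec_eq M N (\<lambda>\<omega>. c *\<^sub>R (X \<omega> - v)) (\<lambda>\<omega>. 0)"
  unfolding cond_exp_vec_eq_def
proof
  fix j
  interpret sigma_finite_subalgebra M N
    using N by (intro finite_measure_subalgebra_is_sigma_finite)
      (simp add: finite_measure_subalgebra_def finite_measure_subalgebra_axioms_def
        finite_measure_axioms)
  have Xj: "integrable M (\<lambda>\<omega>. X \<omega> $ j)"
    using integrable_bounded_linear[OF bounded_linear_vec_nth X] .
  have "AE \<omega> in M. real_cond_exp M N (\<lambda>\<omega>. X \<omega> $ j) \<omega> = v $ j"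
    using eq by (simp add: cond_exp_vec_eq_def)
  moreover have "AE \<omega> in M. real_cond_exp M N (\<lambda>\<omega>. v $ j) \<omega> = v $ j"
    by (rule real_cond_exp_F_meas) auto
  moreover have "AE \<omega> in M. real_cond_exp M N (\<lambda>\<omega>. X \<omega> $ j - v $ j) \<omega> =
      real_cond_exp M N (\<lambda>\<omega>. X \<omega> $ j) \<omega> - real_cond_exp M N (\<lambda>\<omega>. v $ j) \<omega>"
    using Xj by (intro real_cond_exp_diff) auto
  moreover have "AE \<omega> in M. real_cond_exp M N (\<lambda>\<omega>. c * (X \<omega> $ j - v $ j)) \<omega> =
      c * real_cond_exp M N (\<lambda>\<omega>. X \<omega> $ j - v $ j) \<omega>"
    using Xj by (intro real_cond_exp_cmult) auto
  ultimately show "AE \<omega> in M. real_cond_exp M N (\<lambda>\<omega>. (c *\<^sub>R (X \<omega> - v)) $ j) \<omega> = 0 $ j"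
    by eventually_elim simp
qed

theorem corollary2p3:
  fixes F :: "real ^ 'd \<Rightarrow> real"
    and L\<^sub>2 :: real
    and T :: nat
    and M :: "'w measure"
    and x :: "nat \<Rightarrow> real ^ 'd"
    and a :: "nat \<Rightarrow> 'w \<Rightarrow> real ^ 'd"
  assumes "has_partials F"
    and "\<And>j. smooth_l1 L\<^sub>2 (partial F j)"
    and "1 \<le> T"
    and "prob_space M"
    and "\<And>t. t \<in> {1..T} \<Longrightarrow> x t \<in> prob_simplex"
    and "\<And>t. t \<in> {1..T} \<Longrightarrow> a t \<in> borel_measurable M"
    and "\<And>t. t \<in> {1..T} \<Longrightarrow> AE \<omega> in M. a t \<omega> \<in> prob_simplex"
    and "\<And>t. t \<in> {1..T} \<Longrightarrow> cond_exp_vec_eq M (past_algebra M a t) (a t) (\<lambda>\<omega>. x t)"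
  shows "infnorm (\<integral>\<omega>. (grad F (average T (\<lambda>t. a t \<omega>)) - grad F (average T x)) \<partial>M)
           \<le> 2 * L\<^sub>2 / real T"
proof -
  interpret prob_space M by fact
  note smooth = assms(2) and T = assms(3) and x = assms(5) and a = assms(6) and simplex = assms(7)
  define D where "D t \<omega> = (1 / real T) *\<^sub>R (a t \<omega> - x t)" for t \<omega>
  have a_norm: "AE \<omega> in M. norm (a t \<omega>) \<le> 1" if "t \<in> {1..T}" for t
    using simplex[OF that] by eventually_elim (metis norm_le_l1norm l1norm_prob_simplex)
  have sub: "subalgebra M (past_algebra M a t)" if "t \<in> {1..T}" for t
    using that a by (intro subalgebra_past_algebra) auto
  have avg: "average T (\<lambda>t. a t \<omega>) = average T x + (\<Sum>t = 1..T. D t \<omega>)" for \<omega>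
    by (simp add: average_def D_def sum_subtractf scaleR_diff_right flip: scaleR_sum_right)
  \<comment> \<open>The maximum norm permits treating one coordinate at a time, with
    \<open>partial F j\<close> as the smooth function \<open>G\<close>.\<close>
  have comp: "\<bar>expectation (\<lambda>\<omega>. partial F j (average T (\<lambda>t. a t \<omega>))) - partial F j (average T x)\<bar>
      \<le> 2 * L\<^sub>2 / real T" for j
  proof -
    have "\<bar>expectation (\<lambda>\<omega>. partial F j (average T x + (\<Sum>t = 1..T. D t \<omega>))) -
        partial F j (average T x)\<bar> \<le> real T * (L\<^sub>2 / 2 * (2 / real T)\<^sup>2)"
    proof (rule expectation_smooth_martingale[OF smooth sub])
      fix s t assume "t \<in> {1..T}" "s \<in> {1..<t}"
      \<comment> \<open>\<open>x s\<close> is deterministic, so \<open>D s\<close> is an affine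
        image of \<open>a s\<close>, one of the generators of the past at \<open>t\<close> because
        \<open>s < t\<close>.\<close>
      then show "D s \<in> borel_measurable (past_algebra M a t)"
        unfolding D_def using measurable_past_algebra[of s t a M] by measurable
    next
      fix t assume t: "t \<in> {1..T}"
      show "D t \<in> borel_measurable M"
        unfolding D_def using a[OF t] by measurable
      show "AE \<omega> in M. l1norm (D t \<omega>) \<le> 2 / real T"
        using simplex[OF t]
      proof eventually_elim
        case (elim \<omega>)
        then show ?case
          using l1norm_diff_prob_simplex[OF elim x[OF t]] T
          by (simp add: D_def l1norm_scaleR divide_right_mono)
      qed
      have "integrable M (a t)"
        using a_norm[OF t] a[OF t] by (rule integrable_const_bound)
      then show "cond_exp_vec_eq M (past_algebra M a t) (D t) (\<lambda>\<omega>. 0)"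
        unfolding D_def using assms(8)[OF t] by (rule cond_exp_vec_eq_centered[OF sub[OF t]])
    qed
    \<comment> \<open>There are \<open>T\<close> errors of size
      \<open>2 * L\<^sub>2 / T\<^sup>2\<close> each, so one factor \<open>1 / T\<close>
      survives.\<close>
    also have "\<dots> = 2 * L\<^sub>2 / real T"
      using T by (simp add: power2_eq_square field_simps)
    finally show ?thesis
      by (simp add: avg)
  qed
  \<comment> \<open>The Bochner integral defaults to 0 on non-integrable functions, so integrability
    must be known before the integral is split and coordinates are moved inside it. The averages lie
    almost surely in the unit ball.\<close>
  have int: "integrable M (\<lambda>\<omega>. grad F (average T (\<lambda>t. a t \<omega>)))"
  proof (rule integrable_continuous_bounded[where g = "grad F"])
    show "continuous_on UNIV (grad F)"
      unfolding grad_def using smooth_l1_continuous[OF smooth]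
      by (intro continuous_on_vec_lambda)
    show "(\<lambda>\<omega>. average T (\<lambda>t. a t \<omega>)) \<in> borel_measurable M"
      unfolding average_def using a
      by (intro borel_measurable_scaleR borel_measurable_sum) auto
    have "AE \<omega> in M. \<forall>t\<in>{1..T}. norm (a t \<omega>) \<le> 1"
      using a_norm by (intro AE_finite_allI) auto
    then show "AE \<omega> in M. norm (average T (\<lambda>t. a t \<omega>)) \<le> 1"
    proof eventually_elim
      case (elim \<omega>)
      have "norm (\<Sum>t = 1..T. a t \<omega>) \<le> (\<Sum>t = 1..T. 1)"
        using elim by (intro sum_norm_le) auto
      then show ?case
        using T by (simp add: average_def field_simps)
    qed
  qed
  show ?thesis
  proof (rule infnorm_le_cart)
    fix j
    have "(\<integral>\<omega>. (grad F (average T (\<lambda>t. a t \<omega>)) - grad F (average T x)) \<partial>M) $ j =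
        (\<integral>\<omega>. grad F (average T (\<lambda>t. a t \<omega>)) $ j \<partial>M) - grad F (average T x) $ j"
      using int integral_bounded_linear[OF bounded_linear_vec_nth int, of j]
      by (simp add: prob_space)
    then show "\<bar>(\<integral>\<omega>. (grad F (average T (\<lambda>t. a t \<omega>)) - grad F (average T x)) \<partial>M) $ j\<bar>
        \<le> 2 * L\<^sub>2 / real T"
      using comp[of j] by (simp add: grad_def)
  qed
qed

end
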